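(* Let $m\ge 0$ be an integer, let $K$ be an edge-path connected simplicial complex, and let $\mathrm{pr}_1,\mathrm{pr}_2:K^2\to K$ be the projections to the first and second factor of the categorical product $K^2=K\times K$. Then $\mathrm{TC}^m(K)=\mathrm{SD}_m(\mathrm{pr}_1,\mathrm{pr}_2)$.
   Context: Simplicial complexes are abstract simplicial complexes. Simplicial maps $f,g:A\to B$ are contiguous, $f\sim_c g$, if for every simplex $\{v_0,\dots,v_k\}$ of $A$ the set $\{f(v_0),\dots,f(v_k),g(v_0),\dots,g(v_k)\}$ is a simplex of $B$. They are in the same contiguity class, $f\sim g$, if there is a finite sequence of simplicial maps $f=f_0\sim_c f_1\sim_c\dots\sim_c f_n=g$ from $A$ to $B$. The categorical product $K\times L$ has as vertices the pairs $(v,w)$ of vertices of $K$ and $L$; a finite set of such pairs is a simplex iff its first coordinates form a simplex of $K$ and its second coordinates form a simplex of $L$. For simplicial maps $\varphi,\psi:A\to B$, the $m$-contiguity distance $\mathrm{SD}_m(\varphi,\psi)$ is the least integer $k\ge 0$ such that $A$ is covered by subcomplexes $A_0,\dots,A_k$ with the property that for each $j$ and every simplicial map $\eta:P\to A_j$ from an $m$-dimensional simplicial complex $P$, $\varphi\circ\eta\sim\psi\circ\eta$ ($\infty$ if no such cover exists). The $m$-discrete topological complexity $\mathrm{TC}^m(K)$ is the least integer $k\ge 0$ such that $K^2$ is covered by subcomplexes $\Omega_0,\dots,\Omega_k$ for each of which there exists a simplicial map $\sigma_j:\Omega_j\to K$ such that for every simplicial map $\eta_j:P\to\Omega_j$ from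 an $m$-dimensional simplicial complex $P$, $\Delta\circ\sigma_j\circ\eta_j\sim\iota_j\circ\eta_j$, where $\iota_j:\Omega_j\hookrightarrow K^2$ is the inclusion and $\Delta:K\to K^2$ is the diagonal map ($\infty$ if no such cover exists). *)

theory Defs
  imports Main "HOL-Library.Extended_Nat"
begin

text \<open>
  A complex is the set of its simplices, so its set of vertices is the union \<open>\<Union>K\<close>.
  Vertex maps are total functions; only their values on vertices matter.
\<close>

definition abstract_simplicial_complex :: "'a set set \<Rightarrow> bool" where
  "abstract_simplicial_complex K \<longleftrightarrow>
     (\<forall>s\<in>K. finite s \<and> s \<noteq> {}) \<and> (\<forall>s\<in>K. \<forall>t. t \<subseteq> s \<and> t \<noteq> {} \<longrightarrow> t \<in> K)"

definition subcomplex :: "'a set set \<Rightarrow> 'a set set \<Rightarrow> bool" where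
  "subcomplex L K \<longleftrightarrow> abstract_simplicial_complex L \<and> L \<subseteq> K"

definition has_dimension :: "'a set set \<Rightarrow> nat \<Rightarrow> bool" where
  "has_dimension K m \<longleftrightarrow> (\<forall>s\<in>K. card s \<le> m + 1) \<and> (\<exists>s\<in>K. card s = m + 1)"

definition edge_path_connected :: "'a set set \<Rightarrow> bool" where
  "edge_path_connected K \<longleftrightarrow>
     (\<forall>v\<in>\<Union>K. \<forall>w\<in>\<Union>K. \<exists>n (p :: nat \<Rightarrow> 'a).
        p 0 = v \<and> p n = w \<and> (\<forall>i<n. {p i, p (Suc i)} \<in> K))"

definition simplicial_map :: "'a set set \<Rightarrow> 'b set set \<Rightarrow> ('a \<Rightarrow> 'b) \<Rightarrow> bool" where
  "simplicial_map A B f \<longleftrightarrow> (\<forall>s\<in>A. f ` s \<in> B)"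

definition contiguous :: "'a set set \<Rightarrow> 'b set set \<Rightarrow> ('a \<Rightarrow> 'b) \<Rightarrow> ('a \<Rightarrow> 'b) \<Rightarrow> bool" where
  "contiguous A B f g \<longleftrightarrow>
     simplicial_map A B f \<and> simplicial_map A B g \<and> (\<forall>s\<in>A. f ` s \<union> g ` s \<in> B)"

text \<open>
  Requiring \<open>F 0 = f\<close> and \<open>F n = g\<close> as total functions is harmless: simplicial maps that
  agree on the vertices of \<open>A\<close> are contiguous.
\<close>

definition same_contiguity_class ::
    "'a set set \<Rightarrow> 'b set set \<Rightarrow> ('a \<Rightarrow> 'b) \<Rightarrow> ('a \<Rightarrow> 'b) \<Rightarrow> bool" where
  "same_contiguity_class A B f g \<longleftrightarrow>
     (\<exists>n (F :: nat \<Rightarrow> 'a \<Rightarrow> 'b). F 0 = f \<and> F n = g \<and>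
        (\<forall>i\<le>n. simplicial_map A B (F i)) \<and> (\<forall>i<n. contiguous A B (F i) (F (Suc i))))"

definition categorical_product ::
    "'a set set \<Rightarrow> 'b set set \<Rightarrow> ('a \<times> 'b) set set" (infixr "\<times>\<^sub>c" 80) where
  "K \<times>\<^sub>c L = {s. finite s \<and> s \<noteq> {} \<and> fst ` s \<in> K \<and> snd ` s \<in> L}"

definition diagonal :: "'a \<Rightarrow> 'a \<times> 'a" where
  "diagonal v = (v, v)"

text \<open>
  Two maps on \<open>A\<close> become equivalent after composition with every simplicial map from an
  \<open>m\<close>-dimensional complex \<open>P\<close>.  HOL cannot quantify over the vertex type of \<open>P\<close> inside a formula,
  so the vertices of \<open>P\<close> are taken from \<open>'a + nat\<close>.  This is no restriction: by
  \<open>m_contiguity_equiv_universal\<close> below, the property then holds for complexes \<open>P\<close> on any type.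
\<close>

definition m_contiguity_equiv ::
    "nat \<Rightarrow> 'a set set \<Rightarrow> 'b set set \<Rightarrow> ('a \<Rightarrow> 'b) \<Rightarrow> ('a \<Rightarrow> 'b) \<Rightarrow> bool" where
  "m_contiguity_equiv m A B f g \<longleftrightarrow>
     (\<forall>(P :: ('a + nat) set set) \<eta>.
        abstract_simplicial_complex P \<and> has_dimension P m \<and> simplicial_map P A \<eta>
        \<longrightarrow> same_contiguity_class P B (f \<circ> \<eta>) (g \<circ> \<eta>))"

lemma same_contiguity_class_precompose:
  assumes "same_contiguity_class A B f g" and "simplicial_map P A h"
  shows "same_contiguity_class P B (f \<circ> h) (g \<circ> h)"
proof -
  obtain n F where F: "F 0 = f" "F n = g" "\<forall>i\<le>n. simplicial_map A B (F i)"
      "\<forall>i<n. contiguous A B (F i) (F (Suc i))"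
    using assms(1) unfolding same_contiguity_class_def by blast
  have "\<forall>i\<le>n. simplicial_map P B (F i \<circ> h)"
    using F(3) assms(2) unfolding simplicial_map_def by (metis image_comp)
  moreover have "\<forall>i<n. contiguous P B (F i \<circ> h) (F (Suc i) \<circ> h)"
    using F(4) assms(2) unfolding contiguous_def simplicial_map_def by (metis image_comp)
  ultimately show ?thesis
    unfolding same_contiguity_class_def
    using F(1,2) by (intro exI[of _ n] exI[of _ "\<lambda>i. F i \<circ> h"]) simp
qed

text \<open>
  Every map from an \<open>m\<close>-dimensional complex to \<open>A\<close> factors through the \<open>m\<close>-skeleton of \<open>A\<close>;
  adding a disjoint \<open>m\<close>-simplex, collapsed to a vertex of \<open>A\<close>, makes its dimension exactly \<open>m\<close>.
\<close>

lemma m_contiguity_equiv_universal: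
  fixes P :: "'p set set" and A :: "'a set set"
  assumes A: "abstract_simplicial_complex A"
    and fg: "m_contiguity_equiv m A B f g"
    and P: "abstract_simplicial_complex P" "has_dimension P m"
    and \<eta>: "simplicial_map P A \<eta>"
  shows "same_contiguity_class P B (f \<circ> \<eta>) (g \<circ> \<eta>)"
proof -
  have A_simplex: "finite t" "t \<noteq> {}" if "t \<in> A" for t
    using A that unfolding abstract_simplicial_complex_def by auto
  have A_down: "t \<in> A" if "u \<in> A" "t \<subseteq> u" "t \<noteq> {}" for t u
    using A that unfolding abstract_simplicial_complex_def by meson
  obtain s where "s \<in> P" using P(2) unfolding has_dimension_def by auto
  then have sA: "\<eta> ` s \<in> A" using \<eta> unfolding simplicial_map_def by auto
  then obtain a where "a \<in> \<eta> ` s" using A_simplex(2) by (metis all_not_in_conv)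
  then have a: "{a} \<in> A" using A_down[OF sA, of "{a}"] by simp
  define S where "S = {t \<in> A. card t \<le> m + 1}"
  define T where "T = {t. t \<subseteq> {..m} \<and> t \<noteq> {}}"
  define Q :: "('a + nat) set set" where "Q = (`) Inl ` S \<union> (`) Inr ` T"
  define \<rho> :: "'a + nat \<Rightarrow> 'a" where "\<rho> = case_sum id (\<lambda>_. a)"
  have T_fin: "finite t" "card t \<le> m + 1" if "t \<in> T" for t
    using that finite_subset[of t "{..m}"] card_mono[of "{..m}" t] unfolding T_def by auto
  have S_down: "t \<in> S" if "u \<in> S" "t \<subseteq> u" "t \<noteq> {}" for t u
    using that A_simplex(1)[of u] A_down[of u t] card_mono[of u t] unfolding S_def by auto
  have S_fin: "finite t" "t \<noteq> {}" if "t \<in> S" for t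
    using that A_simplex unfolding S_def by auto
  have "abstract_simplicial_complex Q"
    unfolding abstract_simplicial_complex_def
  proof (intro conjI ballI allI impI)
    fix u assume "u \<in> Q"
    then show "finite u" "u \<noteq> {}"
      using S_fin T_fin(1) finite_subset[OF _ finite_atMost[of m]]
      unfolding Q_def T_def by (auto intro!: finite_imageI)
  next
    fix u t assume u: "u \<in> Q" and t: "t \<subseteq> u \<and> t \<noteq> {}"
    from u consider w where "w \<in> S" "u = Inl ` w" | w where "w \<in> T" "u = Inr ` w"
      unfolding Q_def by blast
    then show "t \<in> Q"
    proof cases
      case 1
      then obtain x where "x \<subseteq> w" "t = Inl ` x" using t by (meson subset_imageE)
      then show ?thesis using 1 t S_down[of w x] unfolding Q_def by auto
    next
      case 2
      then obtain x where "x \<subseteq> w" "t = Inr ` x" using t by (meson subset_imageE)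
      moreover from this have "x \<in> T" using 2 t unfolding T_def by auto
      ultimately show ?thesis unfolding Q_def by blast
    qed
  qed
  moreover have "has_dimension Q m"
    unfolding has_dimension_def
  proof
    show "\<forall>u\<in>Q. card u \<le> m + 1"
      using T_fin(2) unfolding Q_def S_def by (auto simp: card_image)
    have "Inr ` {..m} \<in> Q" unfolding Q_def T_def by auto
    then show "\<exists>u\<in>Q. card u = m + 1"
      by (rule rev_bexI) (simp add: card_image)
  qed
  moreover have "simplicial_map Q A \<rho>"
    unfolding simplicial_map_def
  proof
    fix u assume "u \<in> Q"
    then consider w where "w \<in> S" "u = Inl ` w" | w where "w \<in> T" "u = Inr ` w"
      unfolding Q_def by blast
    then show "\<rho> ` u \<in> A"
    proof cases
      case 1
      then show ?thesis by (simp add: image_image \<rho>_def S_def)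
    next
      case 2
      then have "\<rho> ` u = {a}" by (auto simp: \<rho>_def T_def image_image)
      then show ?thesis using a by simp
    qed
  qed
  ultimately have "same_contiguity_class Q B (f \<circ> \<rho>) (g \<circ> \<rho>)"
    using fg[unfolded m_contiguity_equiv_def, rule_format, of Q \<rho>] by simp
  moreover have "simplicial_map P Q (Inl \<circ> \<eta>)"
    unfolding simplicial_map_def
  proof
    fix u assume u: "u \<in> P"
    have "finite u"
      using P(1) u unfolding abstract_simplicial_complex_def by simp
    then have "card (\<eta> ` u) \<le> card u" by (rule card_image_le)
    moreover have "card u \<le> m + 1" using P(2) u unfolding has_dimension_def by simp
    ultimately have "card (\<eta> ` u) \<le> m + 1" by (rule le_trans)
    moreover have "\<eta> ` u \<in> A" using u \<eta> unfolding simplicial_map_def by simp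
    ultimately have "\<eta> ` u \<in> S" unfolding S_def by simp
    then have "Inl ` \<eta> ` u \<in> Q" unfolding Q_def by (intro UnI1 imageI)
    then show "(Inl \<circ> \<eta>) ` u \<in> Q" by (simp only: image_comp)
  qed
  ultimately have "same_contiguity_class P B (f \<circ> \<rho> \<circ> (Inl \<circ> \<eta>)) (g \<circ> \<rho> \<circ> (Inl \<circ> \<eta>))"
    by (rule same_contiguity_class_precompose)
  moreover have "f \<circ> \<rho> \<circ> (Inl \<circ> \<eta>) = f \<circ> \<eta>" "g \<circ> \<rho> \<circ> (Inl \<circ> \<eta>) = g \<circ> \<eta>"
    by (simp_all add: fun_eq_iff \<rho>_def)
  ultimately show ?thesis by simp
qed

text \<open>In both invariants below the infimum of the empty set is \<open>\<infinity>\<close>.\<close>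

definition SD :: "nat \<Rightarrow> 'a set set \<Rightarrow> 'b set set \<Rightarrow> ('a \<Rightarrow> 'b) \<Rightarrow> ('a \<Rightarrow> 'b) \<Rightarrow> enat" where
  "SD m A B \<phi> \<psi> = Inf {enat k | k. \<exists>U :: nat \<Rightarrow> 'a set set.
      (\<forall>j\<le>k. subcomplex (U j) A) \<and> A = (\<Union>j\<le>k. U j) \<and>
      (\<forall>j\<le>k. m_contiguity_equiv m (U j) B \<phi> \<psi>)}"

text \<open>The inclusion \<open>\<Omega> j \<hookrightarrow> K \<times>\<^sub>c K\<close> is the identity on vertices.\<close>

definition TC :: "nat \<Rightarrow> 'v set set \<Rightarrow> enat" where
  "TC m K = Inf {enat k | k. \<exists>\<Omega> :: nat \<Rightarrow> ('v \<times> 'v) set set.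
      (\<forall>j\<le>k. subcomplex (\<Omega> j) (K \<times>\<^sub>c K)) \<and> K \<times>\<^sub>c K = (\<Union>j\<le>k. \<Omega> j) \<and>
      (\<forall>j\<le>k. \<exists>\<sigma>. simplicial_map (\<Omega> j) K \<sigma> \<and>
         m_contiguity_equiv m (\<Omega> j) (K \<times>\<^sub>c K) (diagonal \<circ> \<sigma>) id)}"

end

theory Submission
  imports Defs
begin

text \<open>
  Both invariants range over the same covers, so it suffices to compare the conditions on one
  piece \<open>\<Omega>\<close>. Given \<open>\<sigma>\<close>, the maps \<open>fst \<circ> \<eta>\<close> and \<open>snd \<circ> \<eta>\<close> both lie in the class of \<open>\<sigma> \<circ> \<eta>\<close>, because
  \<open>\<sigma> \<circ> \<eta>\<close> is either projection of \<open>\<Delta> \<circ> \<sigma> \<circ> \<eta>\<close>. Conversely one takes \<open>\<sigma> = fst\<close>: pairing a chain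
  from \<open>fst \<circ> \<eta>\<close> to \<open>snd \<circ> \<eta>\<close> with the constant chain \<open>fst \<circ> \<eta>\<close> joins \<open>\<Delta> \<circ> fst \<circ> \<eta>\<close> to \<open>\<eta>\<close>.
\<close>

text \<open>Makes library facts on closures available for symmetry and transitivity. The conjunct on
  \<open>f\<close> excludes chains of length 0 at a map that is not simplicial, which the closure
  alone would admit.\<close>

lemma same_contiguity_class_iff_rtranclp:
  "same_contiguity_class A B f g \<longleftrightarrow> simplicial_map A B f \<and> (contiguous A B)\<^sup>*\<^sup>* f g"
proof
  assume "same_contiguity_class A B f g"
  then obtain n F where F: "F 0 = f" "F n = g" "\<forall>i\<le>n. simplicial_map A B (F i)"
      "\<forall>i<n. contiguous A B (F i) (F (Suc i))"
    unfolding same_contiguity_class_def by blast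
  then have "(contiguous A B ^^ n) f g"
    unfolding relpowp_fun_conv by blast
  then show "simplicial_map A B f \<and> (contiguous A B)\<^sup>*\<^sup>* f g"
    using F(1,3) relpowp_imp_rtranclp by fastforce
next
  assume *: "simplicial_map A B f \<and> (contiguous A B)\<^sup>*\<^sup>* f g"
  then obtain n F where F: "F 0 = f" "F n = g" "\<forall>i<n. contiguous A B (F i) (F (Suc i))"
    by (metis rtranclp_imp_relpowp relpowp_fun_conv)
  \<comment> \<open>\<open>F 0\<close> is \<open>f\<close>; every later \<open>F i\<close> is the
    right end of a contiguity.\<close>
  moreover have "simplicial_map A B (F i)" if "i \<le> n" for i
    using that F * by (cases i) (auto simp: contiguous_def)
  ultimately show "same_contiguity_class A B f g"
    unfolding same_contiguity_class_def by blast
qed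

lemma same_contiguity_class_sym:
  assumes "same_contiguity_class A B f g"
  shows "same_contiguity_class A B g f"
proof -
  \<comment> \<open>The reversed chain starts at \<open>g\<close>, so its closure form asks for
    this.\<close>
  have "simplicial_map A B g"
    using assms unfolding same_contiguity_class_def by blast
  moreover have "symp (contiguous A B)"
    by (auto simp: symp_def contiguous_def Un_commute)
  ultimately show ?thesis
    using assms by (metis same_contiguity_class_iff_rtranclp symp_rtranclp sympD)
qed

lemma same_contiguity_class_trans:
  assumes "same_contiguity_class A B f g" and "same_contiguity_class A B g h"
  shows "same_contiguity_class A B f h"
  using assms by (auto simp: same_contiguity_class_iff_rtranclp)

text \<open>\<open>\<Phi>\<close> acts on whole maps and not on vertices, so that postcomposition
  and pairing with a fixed map are both instances: it is applied to each link of the chain.\<close>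

lemma same_contiguity_class_map:
  assumes "same_contiguity_class A B f g"
    and "\<And>u. simplicial_map A B u \<Longrightarrow> simplicial_map A C (\<Phi> u)"
    and "\<And>u v. contiguous A B u v \<Longrightarrow> contiguous A C (\<Phi> u) (\<Phi> v)"
  shows "same_contiguity_class A C (\<Phi> f) (\<Phi> g)"
proof -
  obtain n F where "F 0 = f" "F n = g" "\<forall>i\<le>n. simplicial_map A B (F i)"
      "\<forall>i<n. contiguous A B (F i) (F (Suc i))"
    using assms(1) unfolding same_contiguity_class_def by blast
  then show ?thesis
    unfolding same_contiguity_class_def
    using assms(2,3) by (intro exI[of _ n] exI[of _ "\<lambda>i. \<Phi> (F i)"]) simp
qed

lemma simplicial_map_comp:
  assumes "simplicial_map A B f" and "simplicial_map B C g"
  shows "simplicial_map A C (g \<circ> f)"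
  using assms unfolding simplicial_map_def by (metis image_comp)

lemma same_contiguity_class_postcompose:
  assumes "same_contiguity_class A B f g" and "simplicial_map B C h"
  shows "same_contiguity_class A C (h \<circ> f) (h \<circ> g)"
  using assms(1)
proof (rule same_contiguity_class_map)
  show "simplicial_map A C (h \<circ> u)" if "simplicial_map A B u" for u
    using that assms(2) by (rule simplicial_map_comp)
  show "contiguous A C (h \<circ> u) (h \<circ> v)" if "contiguous A B u v" for u v
    using that assms(2) unfolding contiguous_def simplicial_map_def
    by (metis image_comp image_Un)
qed

lemma same_contiguity_class_pair:
  assumes A: "abstract_simplicial_complex A" and u: "simplicial_map A B u"
    and fg: "same_contiguity_class A C f g"
  shows "same_contiguity_class A (B \<times>\<^sub>c C) (\<lambda>x. (u x, f x)) (\<lambda>x. (u x, g x))"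
  using fg
proof (rule same_contiguity_class_map)
  have A_simplex: "finite s" "s \<noteq> {}" if "s \<in> A" for s
    using A that by (auto simp: abstract_simplicial_complex_def)
  show pair: "simplicial_map A (B \<times>\<^sub>c C) (\<lambda>x. (u x, v x))" if "simplicial_map A C v" for v
    using that u A_simplex
    by (simp add: simplicial_map_def categorical_product_def image_image)
  show "contiguous A (B \<times>\<^sub>c C) (\<lambda>x. (u x, v x)) (\<lambda>x. (u x, w x))"
    if "contiguous A C v w" for v w
    using that u A_simplex pair
    by (simp add: contiguous_def simplicial_map_def categorical_product_def image_image image_Un)
qed

lemma simplicial_map_fst: "simplicial_map (K \<times>\<^sub>c L) K fst"
  and simplicial_map_snd: "simplicial_map (K \<times>\<^sub>c L) L snd"
  by (auto simp: simplicial_map_def categorical_product_def)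

lemma m_contiguity_equiv_projections:
  assumes "m_contiguity_equiv m \<Omega> (K \<times>\<^sub>c K) (diagonal \<circ> \<sigma>) id"
  shows "m_contiguity_equiv m \<Omega> K fst snd"
  unfolding m_contiguity_equiv_def
proof (intro allI impI)
  fix P and \<eta> :: "('a \<times> 'a) + nat \<Rightarrow> 'a \<times> 'a"
  assume "abstract_simplicial_complex P \<and> has_dimension P m \<and> simplicial_map P \<Omega> \<eta>"
  then have *: "same_contiguity_class P (K \<times>\<^sub>c K) (diagonal \<circ> \<sigma> \<circ> \<eta>) \<eta>"
    using assms by (simp add: m_contiguity_equiv_def)
  have "fst \<circ> (diagonal \<circ> \<sigma> \<circ> \<eta>) = \<sigma> \<circ> \<eta>" "snd \<circ> (diagonal \<circ> \<sigma> \<circ> \<eta>) = \<sigma> \<circ> \<eta>"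
    by (simp_all add: fun_eq_iff diagonal_def)
  then have "same_contiguity_class P K (\<sigma> \<circ> \<eta>) (fst \<circ> \<eta>)"
    and "same_contiguity_class P K (\<sigma> \<circ> \<eta>) (snd \<circ> \<eta>)"
    using same_contiguity_class_postcompose[OF * simplicial_map_fst]
      same_contiguity_class_postcompose[OF * simplicial_map_snd] by simp_all
  then show "same_contiguity_class P K (fst \<circ> \<eta>) (snd \<circ> \<eta>)"
    by (blast intro: same_contiguity_class_sym same_contiguity_class_trans)
qed

lemma m_contiguity_equiv_diagonal_fst:
  assumes \<Omega>: "simplicial_map \<Omega> K fst" and eq: "m_contiguity_equiv m \<Omega> K fst snd"
  shows "m_contiguity_equiv m \<Omega> (K \<times>\<^sub>c K) (diagonal \<circ> fst) id"
  unfolding m_contiguity_equiv_def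
proof (intro allI impI)
  fix P and \<eta> :: "('a \<times> 'a) + nat \<Rightarrow> 'a \<times> 'a"
  assume P: "abstract_simplicial_complex P \<and> has_dimension P m \<and> simplicial_map P \<Omega> \<eta>"
  then have "same_contiguity_class P K (fst \<circ> \<eta>) (snd \<circ> \<eta>)"
    using eq by (simp add: m_contiguity_equiv_def)
  moreover have "simplicial_map P K (fst \<circ> \<eta>)"
    using P \<Omega> by (blast intro: simplicial_map_comp)
  ultimately have "same_contiguity_class P (K \<times>\<^sub>c K)
      (\<lambda>x. ((fst \<circ> \<eta>) x, (fst \<circ> \<eta>) x)) (\<lambda>x. ((fst \<circ> \<eta>) x, (snd \<circ> \<eta>) x))"
    using P by (blast intro: same_contiguity_class_pair)
  \<comment> \<open>By surjective pairing the second map is \<open>\<eta>\<close> itself.\<close>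
  then show "same_contiguity_class P (K \<times>\<^sub>c K) (diagonal \<circ> fst \<circ> \<eta>) (id \<circ> \<eta>)"
    by (simp add: diagonal_def comp_def)
qed

lemma motion_planner_iff:
  assumes "subcomplex \<Omega> (K \<times>\<^sub>c K)"
  shows "(\<exists>\<sigma>. simplicial_map \<Omega> K \<sigma> \<and> m_contiguity_equiv m \<Omega> (K \<times>\<^sub>c K) (diagonal \<circ> \<sigma>) id)
    \<longleftrightarrow> m_contiguity_equiv m \<Omega> K fst snd"
proof -
  have "simplicial_map \<Omega> K fst"
    using assms simplicial_map_fst[of K K] by (auto simp: subcomplex_def simplicial_map_def)
  then show ?thesis
    using m_contiguity_equiv_projections m_contiguity_equiv_diagonal_fst by blast
qed

theorem theorem6p1:
  fixes m :: nat and K :: "'v set set"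
  assumes "abstract_simplicial_complex K"
    and "edge_path_connected K"
  shows "TC m K = SD m (K \<times>\<^sub>c K) K fst snd"
  unfolding TC_def SD_def
  \<comment> \<open>For each \<open>k\<close> the same family of subcomplexes witnesses both
    sides.\<close>
  by (rule arg_cong[of _ _ Inf], rule Collect_cong) (metis (lifting) motion_planner_iff)

end
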